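(* If $G$ is a connected graph of order $n\ge 3$, then $$\frac{\rho_1(G)}{\rho_2(G)}\ \le\ \frac{n-1}{n-2},$$ and equality holds if and only if $G=K_n$ (the complete graph on $n$ vertices).
   Context: All graphs are finite, undirected, simple and connected. The distance matrix $\mathcal{D}(G)$ of a graph $G$ on vertices $1,\dots,n$ is the $n\times n$ matrix whose $(i,j)$ entry is the length of a shortest path from $i$ to $j$. A real number $\lambda$ is a Pareto eigenvalue of a real $n\times n$ matrix $A$ if there is a nonzero vector $\mathbf{x}\in\mathbb{R}^n$, $\mathbf{x}\ge 0$ (entrywise), with $A\mathbf{x}\ge\lambda\mathbf{x}$ (entrywise) and $\lambda=\frac{\mathbf{x}^TA\mathbf{x}}{\mathbf{x}^T\mathbf{x}}$. The distance Pareto eigenvalues of $G$ are the Pareto eigenvalues of $\mathcal{D}(G)$. $\rho_k(G)$ denotes the $k$-th largest element of the set of distinct distance Pareto eigenvalues of $G$. *)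

theory Defs
  imports "HOL-Analysis.Analysis" "Graph_Theory.Graph_Theory"
begin

text \<open>
  Graphs are the finite symmetric loop-free digraphs without parallel arcs of \<open>Graph_Theory\<close>
  (\<^const>\<open>pair_graph\<close>). A graph of order \<open>n\<close> has as its vertex set the whole of a finite type with
  \<open>n\<close> elements, which also indexes the rows and columns of the distance matrix.
\<close>

text \<open>In a connected graph the set of path lengths is never empty, so the \<open>LEAST\<close> is attained.\<close>

definition graph_dist :: "'a pair_pre_digraph \<Rightarrow> 'a \<Rightarrow> 'a \<Rightarrow> nat" where
  "graph_dist G u v = (LEAST k. \<exists>p. pre_digraph.apath (with_proj G) u p v \<and> length p = k)"

definition distance_matrix :: "'n::finite pair_pre_digraph \<Rightarrow> real ^ 'n ^ 'n" where
  "distance_matrix G = (\<chi> i j. real (graph_dist G i j))"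

text \<open>The order on vectors is entrywise.\<close>

definition pareto_eigenvalue :: "real ^ 'n ^ 'n \<Rightarrow> real \<Rightarrow> bool" where
  "pareto_eigenvalue A l \<longleftrightarrow>
     (\<exists>x :: real ^ 'n. x \<noteq> 0 \<and> 0 \<le> x \<and> l *\<^sub>R x \<le> A *v x \<and> l = (x \<bullet> (A *v x)) / (x \<bullet> x))"

definition distance_pareto_eigenvalues :: "'n::finite pair_pre_digraph \<Rightarrow> real set" where
  "distance_pareto_eigenvalues G = {l. pareto_eigenvalue (distance_matrix G) l}"

text \<open>
  Counted from \<open>k = 1\<close>. The element is unspecified if it does not exist; \<^const>\<open>card\<close> being \<open>0\<close> on
  infinite sets, it can only exist for \<open>k \<ge> 1\<close> if finitely many elements of \<open>S\<close> lie above it.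
\<close>

definition kth_largest :: "nat \<Rightarrow> real set \<Rightarrow> real" where
  "kth_largest k S = (THE l. l \<in> S \<and> card {m \<in> S. l \<le> m} = k)"

definition pareto_rho :: "nat \<Rightarrow> 'n::finite pair_pre_digraph \<Rightarrow> real" where
  "pareto_rho k G = kth_largest k (distance_pareto_eigenvalues G)"

end

theory Submission
  imports Defs
begin

text \<open>
  Complementary slackness identifies the Pareto eigenvalues of a nonnegative symmetric matrix \<open>A\<close>
  with positive off-diagonal entries as the Perron roots of its principal submatrices. By strict
  monotonicity of the Perron root, the largest is the root \<open>\<rho>\<close> of \<open>A\<close> itself, and the second largest,
  \<open>P\<close>, is attained by deleting a single index. Let \<open>x\<close> be the unit Perron vector of \<open>A\<close>. Setting the
  entry \<open>x\<^sub>v\<close> to zero gives a test vector which shows \<open>\<rho> (1 - 2 x\<^sub>v\<^sup>2) \<le> P (1 - x\<^sub>v\<^sup>2)\<close>; the sum over all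
  \<open>v\<close> is \<open>\<rho> (n - 2) \<le> P (n - 1)\<close>. Equality forces equality for each \<open>v\<close>, so \<open>x\<close> is constant and each
  truncation of \<open>x\<close> is again a Perron vector, whence all off-diagonal entries of \<open>A\<close> agree; in a
  distance matrix they are then equal to 1.
\<close>

section \<open>Rayleigh quotients on coordinate subspaces\<close>

text \<open>Principal submatrices of all sizes act on the same space \<open>real ^ 'n\<close>, so
  roots for different index sets are compared without a change of type.\<close>

definition supported :: "'n set \<Rightarrow> (real ^ 'n) set" where
  "supported S = {x. \<forall>i. i \<notin> S \<longrightarrow> x $ i = 0}"

text \<open>For nonnegative symmetric \<open>A\<close> this is the Perron root of the principal submatrix on \<open>S\<close>.\<close>

definition perron_root :: "real ^ 'n ^ 'n \<Rightarrow> 'n::finite set \<Rightarrow> real" where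
  "perron_root A S = Sup ((\<lambda>x. x \<bullet> (A *v x)) ` {x \<in> supported S. norm x = 1})"

lemma supported_mono: "S \<subseteq> T \<Longrightarrow> supported S \<subseteq> supported T"
  by (auto simp: supported_def)

lemma supported_add: "x \<in> supported S \<Longrightarrow> y \<in> supported S \<Longrightarrow> x + y \<in> supported S"
  by (auto simp: supported_def)

lemma supported_scaleR: "x \<in> supported S \<Longrightarrow> c *\<^sub>R x \<in> supported S"
  by (auto simp: supported_def)

lemma supported_axis: "i \<in> S \<Longrightarrow> axis i c \<in> supported S"
  by (auto simp: supported_def axis_def)

lemma closed_supported: "closed (supported S :: (real ^ 'n::finite) set)"
proof -
  have "supported S = (\<Inter>i\<in>-S. {x :: real ^ 'n. x $ i = 0})"
    by (auto simp: supported_def)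
  moreover have "closed {x :: real ^ 'n. x $ i = 0}" for i
    by (intro closed_Collect_eq continuous_intros)
  ultimately show ?thesis
    by auto
qed

lemma compact_supported_sphere: "compact {x \<in> supported S :: (real ^ 'n::finite) set. norm x = 1}"
proof -
  have "{x \<in> supported S. norm x = 1} = supported S \<inter> (sphere 0 1 :: (real ^ 'n) set)"
    by auto
  then show ?thesis
    by (simp add: closed_supported closed_Int_compact)
qed

lemma continuous_quadratic_form: "continuous_on X (\<lambda>x :: real ^ 'n::finite. x \<bullet> (A *v x))"
  by (intro continuous_intros matrix_vector_mult_linear_continuous_on)

lemma perron_root_attained:
  fixes A :: "real ^ 'n::finite ^ 'n"
  assumes "S \<noteq> {}"
  obtains x where "x \<in> supported S" "norm x = 1" "x \<bullet> (A *v x) = perron_root A S"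
    "\<And>y. y \<in> supported S \<Longrightarrow> y \<bullet> (A *v y) \<le> perron_root A S * (y \<bullet> y)"
proof -
  let ?X = "{x \<in> supported S :: (real ^ 'n) set. norm x = 1}"
  let ?Q = "\<lambda>x :: real ^ 'n. x \<bullet> (A *v x)"
  obtain i where "i \<in> S"
    using assms by auto
  then have "axis i 1 \<in> ?X"
    by (simp add: supported_axis)
  then have "?X \<noteq> {}"
    by blast
  then obtain x where x: "x \<in> ?X" and max: "\<And>y. y \<in> ?X \<Longrightarrow> ?Q y \<le> ?Q x"
    using continuous_attains_sup[OF compact_supported_sphere _ continuous_quadratic_form] by blast
  have eq: "?Q x = perron_root A S"
    unfolding perron_root_def by (rule cSup_eq_maximum[symmetric]) (use x max in auto)
  have "?Q y \<le> perron_root A S * (y \<bullet> y)" if "y \<in> supported S" for y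
  proof (cases "y = 0")
    case False
    define z where "z = (1 / norm y) *\<^sub>R y"
    have "z \<in> ?X"
      using that False by (simp add: z_def supported_scaleR)
    then have "?Q z \<le> perron_root A S"
      using max eq by metis
    moreover have "?Q z = ?Q y / (y \<bullet> y)"
      by (simp add: z_def matrix_vector_mult_scaleR power2_norm_eq_inner[symmetric] power2_eq_square)
    ultimately show ?thesis
      using False by (simp add: divide_le_eq)
  qed simp
  then show thesis
    using that x eq by blast
qed

text \<open>Empty \<open>S\<close> is covered too: only the zero vector is supported there, so the
  value of the supremum of the empty set does not matter.\<close>

lemma perron_root_ge:
  assumes "y \<in> supported S"
  shows "y \<bullet> (A *v y) \<le> perron_root A S * (y \<bullet> y)"
proof (cases "S = {}")
  case True
  then have "y = 0"
    using assms by (simp add: supported_def vec_eq_iff)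
  then show ?thesis
    by simp
next
  case False
  then show ?thesis
    using perron_root_attained assms by metis
qed

lemma perron_root_mono:
  assumes "S \<subseteq> T" "S \<noteq> {}"
  shows "perron_root A S \<le> perron_root A T"
proof -
  obtain x where x: "x \<in> supported S" "norm x = 1" "x \<bullet> (A *v x) = perron_root A S"
    using perron_root_attained[OF assms(2)] by metis
  then show ?thesis
    using perron_root_ge[of x T A] supported_mono[OF assms(1)]
    by (auto simp: norm_eq_1 subset_iff)
qed

text \<open>Termwise triangle inequality; it allows a maximizer of the quadratic form to be taken
  nonnegative.\<close>

lemma abs_quadratic_form_ge:
  fixes A :: "real ^ 'n::finite ^ 'n"
  assumes "\<And>i j. 0 \<le> A $ i $ j"
  shows "x \<bullet> (A *v x) \<le> (\<chi> i. \<bar>x $ i\<bar>) \<bullet> (A *v (\<chi> i. \<bar>x $ i\<bar>))"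
proof -
  have "x $ i * (A $ i $ j * x $ j) \<le> \<bar>x $ i\<bar> * (A $ i $ j * \<bar>x $ j\<bar>)" for i j
    using abs_ge_self[of "x $ i * (A $ i $ j * x $ j)"] assms by (simp add: abs_mult)
  then show ?thesis
    by (auto simp: inner_vec_def matrix_vector_mult_def sum_distrib_left intro!: sum_mono)
qed

section \<open>Perron vectors of symmetric matrices with positive off-diagonal entries\<close>

locale positive_offdiagonal_matrix =
  fixes A :: "real ^ 'n::finite ^ 'n"
  assumes symmetric: "transpose A = A"
    and nonneg: "0 \<le> A $ i $ j"
    and offdiagonal_pos: "i \<noteq> j \<Longrightarrow> 0 < A $ i $ j"
begin

lemma inner_commute_matrix: "x \<bullet> (A *v y) = y \<bullet> (A *v x)"
  by (metis dot_lmul_matrix inner_commute symmetric transpose_matrix_vector)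

text \<open>
  \<open>Q z = M (z \<bullet> z) - z \<bullet> A z\<close> is nonnegative on the subspace and zero at \<open>y\<close>; along \<open>y + s e\<^sub>i\<close> its linear
  coefficient must vanish.
\<close>

lemma maximizer_eigen:
  assumes y: "y \<in> supported S" and eq: "M * (y \<bullet> y) \<le> y \<bullet> (A *v y)"
    and bound: "\<And>z. z \<in> supported S \<Longrightarrow> z \<bullet> (A *v z) \<le> M * (z \<bullet> z)"
    and i: "i \<in> S"
  shows "(A *v y) $ i = M * y $ i"
proof -
  let ?e = "axis i 1 :: real ^ 'n"
  define c where "c = M * y $ i - (A *v y) $ i"
  define q where "q = M - ?e \<bullet> (A *v ?e)"
  have q: "0 \<le> q"
    using bound[OF supported_axis[OF i], of 1] by (simp add: q_def inner_axis_axis)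
  have eq': "y \<bullet> (A *v y) = M * (y \<bullet> y)"
    using eq bound[OF y] by simp
  have "0 \<le> 2 * s * c + s\<^sup>2 * q" for s
  proof -
    let ?z = "y + s *\<^sub>R ?e"
    have "?z \<bullet> (A *v ?z) \<le> M * (?z \<bullet> ?z)"
      by (intro bound supported_add y supported_scaleR supported_axis i)
    moreover have "?z \<bullet> (A *v ?z) = y \<bullet> (A *v y) + 2 * s * (A *v y) $ i + s\<^sup>2 * (?e \<bullet> (A *v ?e))"
      using inner_commute_matrix[of y ?e]
      by (simp add: matrix_vector_right_distrib matrix_vector_mult_scaleR inner_add_left inner_add_right
          inner_axis' power2_eq_square distrib_left)
    moreover have "?z \<bullet> ?z = y \<bullet> y + 2 * s * y $ i + s\<^sup>2"
      by (simp add: inner_add_left inner_add_right inner_axis inner_axis' power2_eq_square distrib_left)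
    ultimately have "M * (y \<bullet> y) + 2 * s * (A *v y) $ i + s\<^sup>2 * (?e \<bullet> (A *v ?e))
        \<le> M * (y \<bullet> y + 2 * s * y $ i + s\<^sup>2)"
      using eq' by metis
    then show ?thesis
      by (simp add: c_def q_def algebra_simps)
  qed
  \<comment> \<open>A nonzero \<open>c\<close> would make the expression negative for a suitable
    \<open>s\<close> of opposite sign. The minimizer is \<open>- c / q\<close>; the denominator
    \<open>q + 1\<close> also serves \<open>q = 0\<close>.\<close>
  from this[of "- c / (q + 1)"] have "0 \<le> - (c\<^sup>2 * (q + 2)) / (q + 1)\<^sup>2"
    using q by (simp add: power2_eq_square divide_simps) (simp add: algebra_simps)
  then have "c\<^sup>2 * (q + 2) \<le> 0"
    using q zero_less_power[of "q + 1" 2] by (simp add: divide_le_0_iff)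
  then have "c = 0"
    using q by (simp add: mult_le_0_iff)
  then show ?thesis
    by (simp add: c_def)
qed

text \<open>The entrywise absolute value of a maximizer is again a maximizer, hence satisfies the
  eigenvalue equation on \<open>S\<close>.\<close>

lemma perron_vector:
  assumes "S \<noteq> {}"
  obtains x where "x \<in> supported S" "0 \<le> x" "x \<bullet> x = 1" "x \<bullet> (A *v x) = perron_root A S"
    "\<And>i. i \<in> S \<Longrightarrow> (A *v x) $ i = perron_root A S * x $ i"
proof -
  obtain x where x: "x \<in> supported S" "norm x = 1" "x \<bullet> (A *v x) = perron_root A S"
    and bound: "\<And>y. y \<in> supported S \<Longrightarrow> y \<bullet> (A *v y) \<le> perron_root A S * (y \<bullet> y)"
    using perron_root_attained[OF assms] by metis
  define y where "y = (\<chi> i. \<bar>x $ i\<bar>)"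
  have y: "y \<in> supported S" "0 \<le> y"
    using x by (auto simp: y_def supported_def less_eq_vec_def)
  have 1: "y \<bullet> y = 1"
    using x(2) by (simp add: y_def inner_vec_def norm_eq_1)
  have ge: "perron_root A S * (y \<bullet> y) \<le> y \<bullet> (A *v y)"
    using abs_quadratic_form_ge[OF nonneg, of x] x 1 by (simp add: y_def)
  then have "y \<bullet> (A *v y) = perron_root A S"
    using bound[OF y(1)] 1 by simp
  then show thesis
    using that y 1 maximizer_eigen[OF y(1) ge bound] by blast
qed

lemma matrix_vector_nonneg: "0 \<le> x \<Longrightarrow> 0 \<le> (A *v x) $ i"
  by (auto simp: matrix_vector_mult_def less_eq_vec_def nonneg intro!: sum_nonneg)

lemma matrix_vector_pos:
  assumes "0 \<le> x" "x \<noteq> 0" "x $ i = 0"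
  shows "0 < (A *v x) $ i"
proof -
  obtain j where j: "x $ j \<noteq> 0"
    using assms(2) by (auto simp: vec_eq_iff)
  then have "0 < A $ i $ j * x $ j"
    using assms offdiagonal_pos[of i j]
    by (intro mult_pos_pos) (auto simp: less_eq_vec_def order_less_le)
  then show ?thesis
    using assms nonneg unfolding matrix_vector_mult_def
    by (auto simp: less_eq_vec_def intro!: sum_pos2[of _ j])
qed

text \<open>If the roots agreed, the Perron vector \<open>x\<close> of \<open>S\<close> would also
  be a maximizer on \<open>T\<close>. The eigenvalue equation at an index of \<open>T - S\<close>
  then gives \<open>(A *v x) $ i = 0\<close>, against the positive off-diagonal entries, which play
  the role of irreducibility.\<close>

lemma perron_root_strict_mono:
  assumes "S \<subset> T" "S \<noteq> {}"
  shows "perron_root A S < perron_root A T"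
proof (rule ccontr)
  assume "\<not> ?thesis"
  then have eq: "perron_root A T = perron_root A S"
    using perron_root_mono[of S T A] assms by auto
  obtain x where x: "x \<in> supported S" "0 \<le> x" "x \<bullet> x = 1" "x \<bullet> (A *v x) = perron_root A S"
    using perron_vector[OF assms(2)] by metis
  have x0: "x \<noteq> 0"
    using x(3) by auto
  obtain i where i: "i \<in> T" "i \<notin> S"
    using assms by auto
  have "(A *v x) $ i = perron_root A S * x $ i"
  proof (rule maximizer_eigen[of x T])
    show "x \<in> supported T"
      using x(1) assms(1) supported_mono by blast
    show "z \<bullet> (A *v z) \<le> perron_root A S * (z \<bullet> z)" if "z \<in> supported T" for z
      using perron_root_ge[OF that, of A] eq by simp
  qed (use x i in auto)
  moreover have "x $ i = 0"
    using x(1) i by (simp add: supported_def)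
  ultimately show False
    using matrix_vector_pos[OF x(2) x0, of i] by simp
qed

text \<open>By symmetry, pairing \<open>x\<close> with the nonnegative Perron vector
  \<open>y\<close> of \<open>S\<close> yields both eigenvalues times \<open>y \<bullet> x\<close>,
  which is positive because \<open>x\<close> is positive on \<open>S\<close>.\<close>

lemma perron_root_unique:
  assumes "S \<noteq> {}" and x: "x \<in> supported S" "\<And>i. i \<in> S \<Longrightarrow> 0 < x $ i"
    and eigen: "\<And>i. i \<in> S \<Longrightarrow> (A *v x) $ i = l * x $ i"
  shows "l = perron_root A S"
proof -
  obtain y where y: "y \<in> supported S" "0 \<le> y" "y \<bullet> y = 1"
    and ey: "\<And>i. i \<in> S \<Longrightarrow> (A *v y) $ i = perron_root A S * y $ i"
    using perron_vector[OF assms(1)] by metis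
  \<comment> \<open>The eigenvalue equations are known on \<open>S\<close> only; a supported factor
    hides the other coordinates.\<close>
  have inner: "z \<bullet> w = (\<Sum>i\<in>S. z $ i * w $ i)" if "z \<in> supported S" for z w :: "real ^ 'n"
    unfolding inner_vec_def using that
    by (auto simp: supported_def intro!: sum.mono_neutral_right)
  have "l * (y \<bullet> x) = y \<bullet> (A *v x)"
    using eigen by (simp add: inner[OF y(1)] sum_distrib_left mult.left_commute)
  also have "\<dots> = x \<bullet> (A *v y)"
    by (rule inner_commute_matrix)
  also have "\<dots> = perron_root A S * (x \<bullet> y)"
    using ey by (simp add: inner[OF x(1)] sum_distrib_left mult.left_commute)
  finally have "l * (y \<bullet> x) = perron_root A S * (y \<bullet> x)"
    by (simp add: inner_commute)
  moreover have "0 < y \<bullet> x"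
  proof -
    obtain j where j: "y $ j \<noteq> 0"
      using y(3) by (metis inner_zero_left vec_eq_iff zero_index zero_neq_one)
    then have "j \<in> S"
      using y(1) by (auto simp: supported_def)
    then have "0 < y $ j * x $ j"
      using y(2) x(2) j by (auto simp: less_eq_vec_def order_less_le)
    then show ?thesis
      unfolding inner[OF y(1)] using y(2) x(2) \<open>j \<in> S\<close>
      by (auto simp: less_eq_vec_def less_imp_le intro!: sum_pos2[of _ j])
  qed
  ultimately show ?thesis
    by simp
qed

text \<open>\<open>S\<close> is the support of the Pareto vector: the products
  \<open>x $ i * ((A *v x) $ i - l * x $ i)\<close> are nonnegative with sum 0, so all vanish.
  Conversely, the Perron vector of \<open>S\<close> satisfies the inequality off \<open>S\<close>
  because \<open>A *v x\<close> is nonnegative.\<close>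

lemma pareto_eigenvalue_iff: "pareto_eigenvalue A l \<longleftrightarrow> (\<exists>S. S \<noteq> {} \<and> l = perron_root A S)"
proof
  assume "pareto_eigenvalue A l"
  then obtain x where x: "x \<noteq> 0" "0 \<le> x" "l *\<^sub>R x \<le> A *v x" "l = (x \<bullet> (A *v x)) / (x \<bullet> x)"
    unfolding pareto_eigenvalue_def by blast
  define S where "S = {i. x $ i \<noteq> 0}"
  have "S \<noteq> {}"
    using x(1) by (auto simp: S_def vec_eq_iff)
  moreover have "x \<in> supported S"
    by (simp add: S_def supported_def)
  moreover have "0 < x $ i" if "i \<in> S" for i
    using that x(2) by (simp add: S_def less_eq_vec_def order_less_le)
  moreover have "(A *v x) $ i = l * x $ i" if "i \<in> S" for i
  proof -
    have "x \<bullet> (A *v x) = l * (x \<bullet> x)"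
      using x(1,4) by simp
    then have "x \<bullet> (A *v x - l *\<^sub>R x) = 0"
      by (simp add: inner_diff_right)
    then have "(\<Sum>i\<in>UNIV. x $ i * ((A *v x) $ i - l * x $ i)) = 0"
      by (simp add: inner_vec_def)
    then have "x $ i * ((A *v x) $ i - l * x $ i) = 0"
      using x(2,3) by (subst (asm) sum_nonneg_eq_0_iff) (auto simp: less_eq_vec_def)
    then show ?thesis
      using that by (simp add: S_def)
  qed
  ultimately show "\<exists>S. S \<noteq> {} \<and> l = perron_root A S"
    using perron_root_unique by metis
next
  assume "\<exists>S. S \<noteq> {} \<and> l = perron_root A S"
  then obtain S where S: "S \<noteq> {}" and l: "l = perron_root A S"
    by blast
  obtain x where x: "x \<in> supported S" "0 \<le> x" "x \<bullet> x = 1" "x \<bullet> (A *v x) = l"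
    "\<And>i. i \<in> S \<Longrightarrow> (A *v x) $ i = l * x $ i"
    using perron_vector[OF S] l by metis
  have "l * x $ i \<le> (A *v x) $ i" for i
    using x(1,5) matrix_vector_nonneg[OF x(2)] by (cases "i \<in> S") (auto simp: supported_def)
  then have "l *\<^sub>R x \<le> A *v x"
    by (simp add: less_eq_vec_def)
  moreover have "x \<noteq> 0"
    using x(3) by auto
  ultimately show "pareto_eigenvalue A l"
    unfolding pareto_eigenvalue_def using x by auto
qed

end

section \<open>The two largest Pareto eigenvalues\<close>

text \<open>The sets of elements above two thresholds are nested, so equal finite cardinalities make
  them equal; this gives the uniqueness that \<open>THE\<close> requires.\<close>

lemma kth_largest_eqI:
  assumes "finite E" "l \<in> E" "card {m \<in> E. l \<le> m} = k"
  shows "kth_largest k E = l"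
  unfolding kth_largest_def
proof (rule the_equality)
  have "l' \<le> l''" if "l'' \<in> E" "card {m \<in> E. l' \<le> m} = card {m \<in> E. l'' \<le> m}" for l' l''
  proof (rule ccontr)
    assume "\<not> l' \<le> l''"
    then have "{m \<in> E. l' \<le> m} \<subseteq> {m \<in> E. l'' \<le> m}"
      by auto
    then have "{m \<in> E. l' \<le> m} = {m \<in> E. l'' \<le> m}"
      using that(2) assms(1) by (intro card_subset_eq) auto
    then show False
      using that(1) \<open>\<not> l' \<le> l''\<close> by blast
  qed
  then show "l' = l" if "l' \<in> E \<and> card {m \<in> E. l' \<le> m} = k" for l'
    using that assms by (metis order_antisym)
qed (use assms in auto)

lemma Compl_singleton_nonempty:
  assumes "CARD('n::finite) \<ge> 2"
  shows "- {v :: 'n} \<noteq> {}"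
proof
  assume "- {v} = {}"
  then have "(UNIV :: 'n set) = {v}"
    by auto
  then have "CARD('n) = 1"
    by (metis card_1_singleton_iff One_nat_def)
  then show False
    using assms by simp
qed

context positive_offdiagonal_matrix
begin

text \<open>Together with strict monotonicity this makes the root positive on any set of at least
  two indices.\<close>

lemma perron_root_singleton_nonneg: "0 \<le> perron_root A {i}"
  using perron_root_ge[OF supported_axis[of i "{i}" 1], of A] nonneg[of i i]
  by (simp add: inner_axis_axis inner_axis' matrix_vector_mul_component inner_axis)

lemma perron_root_less_UNIV: "S \<noteq> {} \<Longrightarrow> S \<noteq> UNIV \<Longrightarrow> perron_root A S < perron_root A UNIV"
  by (intro perron_root_strict_mono) auto

lemma finite_pareto_eigenvalues: "finite {l. pareto_eigenvalue A l}"
  by (simp add: pareto_eigenvalue_iff)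

lemma largest_pareto_eigenvalue: "kth_largest 1 {l. pareto_eigenvalue A l} = perron_root A UNIV"
proof (rule kth_largest_eqI[OF finite_pareto_eigenvalues])
  have "{m \<in> {l. pareto_eigenvalue A l}. perron_root A UNIV \<le> m} = {perron_root A UNIV}"
    unfolding pareto_eigenvalue_iff using perron_root_less_UNIV
    by (auto simp: not_less[symmetric])
  then show "card {m \<in> {l. pareto_eigenvalue A l}. perron_root A UNIV \<le> m} = 1"
    by simp
qed (auto simp: pareto_eigenvalue_iff)

text \<open>A nonempty proper \<open>S\<close> misses some \<open>w\<close>, so its root is at most
  that of \<open>- {w}\<close>. Hence only the root of \<open>UNIV\<close> lies above the maximum,
  and it does so strictly.\<close>

lemma second_largest_pareto_eigenvalue:
  assumes "CARD('n) \<ge> 2"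
  shows "kth_largest 2 {l. pareto_eigenvalue A l} = Max (range (\<lambda>v. perron_root A (- {v})))"
    (is "_ = ?P")
proof (rule kth_largest_eqI[OF finite_pareto_eigenvalues])
  have ne: "- {v} \<noteq> {}" for v :: 'n
    using assms by (rule Compl_singleton_nonempty)
  have "?P \<in> range (\<lambda>v. perron_root A (- {v}))"
    by (rule Max_in) auto
  then obtain v where v: "?P = perron_root A (- {v})"
    by (rule rangeE)
  then show P: "?P \<in> {l. pareto_eigenvalue A l}"
    unfolding v mem_Collect_eq pareto_eigenvalue_iff by (intro exI[of _ "- {v}"] conjI refl ne)
  have less: "?P < perron_root A UNIV"
    unfolding v using ne by (intro perron_root_less_UNIV) auto
  have U: "pareto_eigenvalue A (perron_root A UNIV)"
    unfolding pareto_eigenvalue_iff by blast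
  have le: "perron_root A S \<le> ?P" if S: "S \<noteq> {}" "S \<noteq> UNIV" for S
  proof -
    obtain w where "w \<notin> S"
      using S by blast
    then have "perron_root A S \<le> perron_root A (- {w})"
      using S by (intro perron_root_mono) auto
    also have "\<dots> \<le> ?P"
      by (rule Max_ge) auto
    finally show ?thesis .
  qed
  have "{m \<in> {l. pareto_eigenvalue A l}. ?P \<le> m} = {perron_root A UNIV, ?P}"
  proof (intro set_eqI iffI)
    fix m
    assume "m \<in> {m \<in> {l. pareto_eigenvalue A l}. ?P \<le> m}"
    then show "m \<in> {perron_root A UNIV, ?P}"
      using le unfolding pareto_eigenvalue_iff mem_Collect_eq
      by (metis insertCI order_antisym)
  next
    fix m
    assume "m \<in> {perron_root A UNIV, ?P}"
    then show "m \<in> {m \<in> {l. pareto_eigenvalue A l}. ?P \<le> m}"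
      using P U less_imp_le[OF less] order_refl[of ?P] by blast
  qed
  then show "card {m \<in> {l. pareto_eigenvalue A l}. ?P \<le> m} = 2"
    using less_imp_neq[OF less] by (metis card_2_iff)
qed

lemma perron_root_deletion:
  assumes n: "CARD('n) \<ge> 2" and P: "\<And>v. perron_root A (- {v}) \<le> P"
  defines "\<rho> \<equiv> perron_root A UNIV"
  shows "\<rho> * (real CARD('n) - 2) \<le> P * (real CARD('n) - 1)"
    and "\<rho> * (real CARD('n) - 2) = P * (real CARD('n) - 1) \<Longrightarrow> i \<noteq> j \<Longrightarrow> A $ i $ j = \<rho> - P"
proof -
  let ?n = "real CARD('n)"
  obtain x where x: "0 \<le> x" "x \<bullet> x = 1" and Ax: "\<And>i. (A *v x) $ i = \<rho> * x $ i"
    using perron_vector[of UNIV] unfolding \<rho>_def by (metis UNIV_I UNIV_not_empty)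
  have Ax': "A *v x = \<rho> *\<^sub>R x"
    using Ax by (simp add: vec_eq_iff)
  define y where "y v = x - x $ v *\<^sub>R axis v 1" for v
  \<comment> \<open>The slack of the test-vector inequality at \<open>v\<close>. It is nonnegative,
    and the sum over all \<open>v\<close> is the slack of the claim.\<close>
  define f where "f v = P * (1 - (x $ v)\<^sup>2) - \<rho> * (1 - 2 * (x $ v)\<^sup>2)" for v
  have y_supp: "y v \<in> supported (- {v})" for v
    by (simp add: y_def supported_def axis_def)
  have yy: "y v \<bullet> y v = 1 - (x $ v)\<^sup>2" for v
    using x(2) by (simp add: y_def inner_diff_left inner_diff_right inner_axis inner_axis' power2_eq_square)
  have y_ge: "\<rho> * (1 - 2 * (x $ v)\<^sup>2) \<le> y v \<bullet> (A *v y v)" for v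
  proof -
    have "axis v 1 \<bullet> (A *v x) = \<rho> * x $ v"
      by (simp add: Ax inner_axis')
    \<comment> \<open>Both cross terms equal \<open>\<rho> * (x $ v)\<^sup>2\<close> by symmetry and
      the eigenvalue equation. The last term is a multiple of the diagonal entry at
      \<open>v\<close>, so it is nonnegative.\<close>
    then have "y v \<bullet> (A *v y v) = \<rho> * (1 - 2 * (x $ v)\<^sup>2) + (x $ v)\<^sup>2 * (axis v 1 \<bullet> (A *v axis v 1))"
      using x(2) inner_commute_matrix[of x "axis v 1"]
      by (simp add: y_def matrix_vector_mult_diff_distrib matrix_vector_mult_scaleR inner_diff_left
          inner_diff_right Ax' inner_axis' power2_eq_square algebra_simps)
    moreover have "0 \<le> axis v 1 \<bullet> (A *v axis v 1)"
    proof -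
      have "0 \<le> (axis v 1 :: real ^ 'n)"
        by (simp add: less_eq_vec_def axis_def)
      then show ?thesis
        using matrix_vector_nonneg by (simp add: inner_axis')
    qed
    ultimately show ?thesis
      by simp
  qed
  have bound: "z \<bullet> (A *v z) \<le> P * (z \<bullet> z)" if "z \<in> supported (- {v})" for z v
    using perron_root_ge[OF that, of A] mult_right_mono[OF P, of "z \<bullet> z" v] by simp
  have f_nonneg: "0 \<le> f v" for v
    using y_ge[of v] bound[OF y_supp, of v] by (simp add: f_def yy)
  have "(\<Sum>v\<in>UNIV. (x $ v)\<^sup>2) = 1"
    using x(2) by (simp add: inner_vec_def power2_eq_square)
  then have sum_f: "(\<Sum>v\<in>UNIV. f v) = P * (?n - 1) - \<rho> * (?n - 2)"
    by (simp add: f_def sum_subtractf sum_distrib_left[symmetric])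
  show "\<rho> * (?n - 2) \<le> P * (?n - 1)"
    using sum_nonneg[of UNIV f] f_nonneg sum_f by simp
  assume eq: "\<rho> * (?n - 2) = P * (?n - 1)" and ij: "i \<noteq> j"
  have f0: "f v = 0" for v
    using sum_f eq f_nonneg sum_nonneg_eq_0_iff[of UNIV f] by simp
  have "\<rho> > 0"
    using perron_root_singleton_nonneg[of i] perron_root_less_UNIV[of "{i}"] ij unfolding \<rho>_def by fastforce
  \<comment> \<open>Multiplying \<open>f v = 0\<close> by \<open>?n - 1\<close> lets
    \<open>eq\<close> eliminate \<open>P\<close>; after cancelling \<rho>, a linear equation in
    \<open>(x $ v)\<^sup>2\<close> remains.\<close>
  have sq: "(x $ v)\<^sup>2 = 1 / ?n" for v
  proof -
    have "\<rho> * (1 - 2 * (x $ v)\<^sup>2) = P * (1 - (x $ v)\<^sup>2)"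
      using f0[of v] by (simp add: f_def)
    then have "\<rho> * ((1 - 2 * (x $ v)\<^sup>2) * (?n - 1)) = (P * (?n - 1)) * (1 - (x $ v)\<^sup>2)"
      by (simp only: mult.assoc[symmetric]) (simp only: mult_ac)
    also have "\<dots> = \<rho> * ((?n - 2) * (1 - (x $ v)\<^sup>2))"
      using eq by simp
    finally have "(1 - 2 * (x $ v)\<^sup>2) * (?n - 1) = (?n - 2) * (1 - (x $ v)\<^sup>2)"
      using \<open>\<rho> > 0\<close> by simp
    then show ?thesis
      by (simp add: field_simps)
  qed
  have x_eq: "x $ i = x $ j"
    using sq[of i] sq[of j] x(1) power2_eq_iff_nonneg[of "x $ i" "x $ j"]
    by (simp add: less_eq_vec_def)
  have "x $ j \<noteq> 0"
    using sq[of j] by auto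
  \<comment> \<open>Since \<open>f j = 0\<close>, the truncated vector \<open>y j\<close> attains
    the bound \<open>P\<close> on \<open>- {j}\<close>. Its eigenvalue equation at \<open>i\<close>
    differs from that of \<open>x\<close> only by the single entry \<open>A $ i $ j\<close>.\<close>
  have "(A *v y j) $ i = P * y j $ i"
  proof (rule maximizer_eigen[OF y_supp _ bound])
    show "P * (y j \<bullet> y j) \<le> y j \<bullet> (A *v y j)"
      using y_ge[of j] f0[of j] by (simp add: yy f_def)
  qed (use ij in auto)
  moreover have "(A *v y j) $ i = \<rho> * x $ i - x $ j * A $ i $ j"
    by (simp add: y_def matrix_vector_mult_diff_distrib matrix_vector_mult_scaleR Ax'
        matrix_vector_mult_basis column_def)
  moreover have "y j $ i = x $ i"
    using ij by (simp add: y_def axis_def)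
  ultimately have "x $ j * (A $ i $ j - (\<rho> - P)) = 0"
    using x_eq by (simp add: algebra_simps)
  then show "A $ i $ j = \<rho> - P"
    using \<open>x $ j \<noteq> 0\<close> by simp
qed

text \<open>The indicator vector of \<open>S\<close> is a positive eigenvector of the
  submatrix.\<close>

lemma perron_root_ones_offdiagonal:
  assumes A: "\<And>i j. A $ i $ j = (if i = j then 0 else 1)" and S: "S \<noteq> {}"
  shows "perron_root A S = real (card S) - 1"
proof -
  let ?x = "(\<chi> i. if i \<in> S then 1 else 0) :: real ^ 'n"
  have "(A *v ?x) $ i = (real (card S) - 1) * ?x $ i" if "i \<in> S" for i
  proof -
    have "(A *v ?x) $ i = (\<Sum>j\<in>S - {i}. 1)"
      unfolding matrix_vector_mult_def vec_lambda_beta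
      by (rule sum.mono_neutral_cong_right) (auto simp: A)
    then show ?thesis
      using that by (simp add: card_Suc_Diff1[OF finite that, symmetric] del: card_Diff_insert)
  qed
  then have "real (card S) - 1 = perron_root A S"
    by (intro perron_root_unique[OF S, of ?x]) (simp_all add: supported_def)
  then show ?thesis
    by simp
qed

end

section \<open>Distance matrices\<close>

context pair_graph
begin

lemma graph_dist_commute: "graph_dist G u v = graph_dist G v u"
proof -
  have len: "length (rev_path p) = length p" for p :: "('a \<times> 'a) list"
    by (induction p) auto
  have "(\<exists>p. apath u p v \<and> length p = k) \<longleftrightarrow> (\<exists>p. apath v p u \<and> length p = k)" for k
    by (metis apath_rev_path len)
  then show ?thesis
    by (simp add: graph_dist_def)
qed

lemma graph_dist_attained:
  assumes "Digraph_Component.connected (with_proj G)" "u \<in> pverts G" "v \<in> pverts G"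
  obtains p where "apath u p v" "length p = graph_dist G u v"
proof -
  have "strongly_connected (with_proj G)"
    using symmetric_connected_imp_strongly_connected sym_arcs assms(1) by blast
  then have "u \<rightarrow>\<^sup>*\<^bsub>with_proj G\<^esub> v"
    using assms by (auto simp: strongly_connected_def)
  then obtain q where "apath u q v"
    by (auto simp: reachable_apath)
  then have "\<exists>p. apath u p v \<and> length p = graph_dist G u v"
    unfolding graph_dist_def
    by (intro LeastI_ex[of "\<lambda>k. \<exists>p. apath u p v \<and> length p = k"]) auto
  then show thesis
    using that by blast
qed

lemma graph_dist_le: "apath u p v \<Longrightarrow> graph_dist G u v \<le> length p"
  unfolding graph_dist_def by (rule Least_le) auto

lemma graph_dist_self: "u \<in> pverts G \<Longrightarrow> graph_dist G u u = 0"
  using graph_dist_le[of u "[]" u] by (simp add: apath_Nil_iff)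

lemma graph_dist_pos:
  assumes "Digraph_Component.connected (with_proj G)" "u \<in> pverts G" "v \<in> pverts G" "u \<noteq> v"
  shows "0 < graph_dist G u v"
  using graph_dist_attained[OF assms(1-3)] assms(4) by (metis apath_Nil_iff length_greater_0_conv)

lemma graph_dist_eq_1_iff:
  assumes "Digraph_Component.connected (with_proj G)" "u \<in> pverts G" "v \<in> pverts G" "u \<noteq> v"
  shows "graph_dist G u v = 1 \<longleftrightarrow> (u, v) \<in> parcs G"
proof
  assume "graph_dist G u v = 1"
  then obtain e where "apath u [e] v"
    using graph_dist_attained[OF assms(1-3)] by (metis One_nat_def length_0_conv length_Suc_conv)
  then show "(u, v) \<in> parcs G"
    by (cases e) (auto simp: apath_simps)
next
  assume "(u, v) \<in> parcs G"
  then have "apath u [(u, v)] v"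
    using assms by (auto simp: apath_simps)
  then show "graph_dist G u v = 1"
    using graph_dist_le[of u "[(u, v)]" v] graph_dist_pos[OF assms] by simp
qed

text \<open>Supplies a pair at distance 1, which fixes the common distance in the equality
  case.\<close>

lemma exists_neighbour:
  assumes "Digraph_Component.connected (with_proj G)" "u \<in> pverts G" "v \<in> pverts G" "u \<noteq> v"
  obtains w where "(u, w) \<in> parcs G"
proof -
  obtain p where p: "apath u p v"
    using graph_dist_attained[OF assms(1-3)] by metis
  then obtain e q where "p = e # q"
    using assms(4) by (cases p) (auto simp: apath_Nil_iff)
  then show thesis
    using p that[of "snd e"] by (cases e) (auto simp: apath_Cons_iff)
qed

end

theorem theorem3p5:
  fixes G :: "'n::finite pair_pre_digraph" and n :: nat
  assumes "pair_graph G"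
    and "pverts G = UNIV"
    and "Digraph_Component.connected (with_proj G)"
    and "card (pverts G) = n"
    and "n \<ge> 3"
  shows "pareto_rho 1 G / pareto_rho 2 G \<le> (real n - 1) / (real n - 2)
    \<and> (pareto_rho 1 G / pareto_rho 2 G = (real n - 1) / (real n - 2)
         \<longleftrightarrow> complete_digraph n (with_proj G))"
proof -
  interpret pair_graph G
    by fact
  have verts: "u \<in> pverts G" for u
    using assms(2) by simp
  have n: "n = CARD('n)"
    using assms(2,4) by simp
  note dist_pos = graph_dist_pos[OF assms(3) verts verts]
    and dist_1 = graph_dist_eq_1_iff[OF assms(3) verts verts]
  let ?D = "distance_matrix G"
  interpret D: positive_offdiagonal_matrix ?D
    by unfold_locales
      (auto simp: distance_matrix_def transpose_def vec_eq_iff graph_dist_commute dist_pos)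
  define \<rho> where "\<rho> = perron_root ?D UNIV"
  define P where "P = Max (range (\<lambda>v. perron_root ?D (- {v})))"
  have rho: "pareto_rho 1 G = \<rho>" "pareto_rho 2 G = P"
    using D.largest_pareto_eigenvalue D.second_largest_pareto_eigenvalue assms(5)
    by (simp_all add: pareto_rho_def distance_pareto_eigenvalues_def \<rho>_def P_def n)
  have P_ge: "perron_root ?D (- {v}) \<le> P" for v
    unfolding P_def by (rule Max_ge) auto
  \<comment> \<open>Three distinct vertices are needed: deleting \<open>v\<close> must leave a
    proper superset of \<open>{u}\<close>. Positivity of \<open>P\<close> then permits clearing
    denominators.\<close>
  have "P > 0"
  proof -
    obtain T :: "'n set" where T: "card T = 3"
      using assms(5) n obtain_subset_with_card_n[of 3 "UNIV :: 'n set"] by auto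
    from T[unfolded card_3_iff] obtain u v w :: 'n where "u \<noteq> v" "v \<noteq> w" "u \<noteq> w"
      by (elim exE conjE)
    then have "w \<in> - {v}" "{u} \<subseteq> - {v}" "w \<notin> {u}"
      by auto
    then have "perron_root ?D {u} < perron_root ?D (- {v})"
      by (intro D.perron_root_strict_mono psubsetI) blast+
    then show ?thesis
      using D.perron_root_singleton_nonneg[of u] P_ge[of v] by linarith
  qed
  have le: "\<rho> * (real n - 2) \<le> P * (real n - 1)"
    using D.perron_root_deletion(1)[OF _ P_ge] assms(5) by (simp add: \<rho>_def n)
  have ratio_eq: "\<rho> / P = (real n - 1) / (real n - 2) \<longleftrightarrow> \<rho> * (real n - 2) = P * (real n - 1)"
    using \<open>P > 0\<close> assms(5) by (simp add: frac_eq_eq mult.commute)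
  have "\<rho> * (real n - 2) = P * (real n - 1) \<longleftrightarrow> complete_digraph n (with_proj G)"
  proof
    assume eq: "\<rho> * (real n - 2) = P * (real n - 1)"
    then have const: "real (graph_dist G u v) = \<rho> - P" if "u \<noteq> v" for u v
      using D.perron_root_deletion(2)[OF _ P_ge _ that] assms(5)
      by (simp add: \<rho>_def n distance_matrix_def)
    have "- {u} \<noteq> {}" for u :: 'n
      using assms(5) n by (intro Compl_singleton_nonempty) simp
    then obtain u v :: 'n where "u \<noteq> v"
      by blast
    then obtain w where "(u, w) \<in> parcs G"
      using exists_neighbour[OF assms(3) verts verts] by metis
    then have "graph_dist G u w = 1" "u \<noteq> w"
      using dist_1 no_loops' by blast+
    \<comment> \<open>All distances between distinct vertices equal \<open>\<rho> - P\<close>, and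
      the arc from \<open>u\<close> to \<open>w\<close> realizes the value 1; so all distinct
      vertices are adjacent.\<close>
    then have "\<rho> - P = 1"
      using const by fastforce
    then have "(u, v) \<in> parcs G" if "u \<noteq> v" for u v
      using const[OF that] dist_1[OF that] by simp
    then show "complete_digraph n (with_proj G)"
      unfolding complete_digraph_pair_def using assms(2,4) by (auto dest: no_loops')
  next
    assume "complete_digraph n (with_proj G)"
    \<comment> \<open>For the complete graph the roots are explicit: \<open>n - 1\<close> on all
      vertices and \<open>n - 2\<close> after any single deletion.\<close>
    then have "?D $ i $ j = (if i = j then 0 else 1)" for i j
      using assms(2) dist_1[of i j]
      by (auto simp: complete_digraph_pair_def distance_matrix_def graph_dist_self)
    note root = D.perron_root_ones_offdiagonal[OF this]
    have "perron_root ?D (- {v}) = real n - 2" for v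
    proof -
      have "CARD('n) \<ge> 2"
        using assms(5) n by simp
      then show ?thesis
        using root[OF Compl_singleton_nonempty, of v]
        by (simp add: Compl_eq_Diff_UNIV card_Diff_singleton n of_nat_diff)
    qed
    then have "P = real n - 2"
      by (simp add: P_def)
    moreover have "\<rho> = real n - 1"
      by (simp add: \<rho>_def root n)
    ultimately show "\<rho> * (real n - 2) = P * (real n - 1)"
      by simp
  qed
  then show ?thesis
    unfolding rho ratio_eq using le \<open>P > 0\<close> assms(5) by (simp add: divide_simps mult.commute)
qed

end
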